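(* Let $(G,F,\mathcal{C})$ be a framework and let $C_1,C_2\in\mathcal{C}$ be distinct. Then $|E(C_1\cap C_2)|\le 2$, and if equality holds then either (a) $C_1,C_2$ are both circuits, and $C_1\cap C_2$ is a two-edge path whose middle vertex $v$ lies in $V(F)$ and has degree one in $F$; or (b) $C_1,C_2$ are both paths with the same end-edges $e,f$, $C_1\cap C_2$ consists of the disjoint edges $e,f$ and their ends, and $C_1,C_2$ are disjoint from $F$.
   Context: All graphs are finite and simple; paths and circuits have no repeated vertices. The ends of a path are its first and last vertices, its end-edges its first and last edges. For a set of edges $E'$, $G\setminus E'$ is obtained from $G$ by deleting those edges (keeping all vertices). For a path or circuit $C$, a sequence of vertices/edges is "in order" in $C$ if they are met in that order traversing $C$ (from one end if $C$ is a path; from some starting point if $C$ is a circuit). A framework is a triple $(G,F,\mathcal{C})$ where $G$ is cubic, $F$ is a subgraph of $G$, and $\mathcal{C}$ is a set of subgraphs of $G\setminus E(F)$, satisfying (F1)–(F7) below. Distinct edges $e,f$ are twinned if there exist distinct $C_1,C_2\in\mathcal{C}$ with $e,f\in E(C_1\cap C_2)$. (F1) Each member of $\mathcal{C}$ is an induced subgraph of $G\setminus E(F)$, has at least three edges, and is a path or a circuit. (F2) Every edge of $G\setminus E(F)$ belongs to some member of $\mathcal{C}$, and for every two edges $e,f$ of $G$ with a common end not in $V(F)$ there exists $C\in\mathcal{C}$ with $e,f\in E(C)$. (F3) If $C_1,C_2\in\mathcal{C}$ are distinct and $v\in V(C_1\cap C_2)$, then either $V(C_1\cap C_2)=\{v\}$,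 or $v$ is incident with an edge of $C_1\cap C_2$, or $v\in V(F)$. (F4) If $C_1\in\mathcal{C}$ is a path, every member of $\mathcal{C}$ containing an end-edge of $C_1$ is a path; and if $C_2\in\mathcal{C}\setminus\{C_1\}$ is also a path, then every component of $C_1\cap C_2$ contains an end of $C_1$, and every edge of $C_1\cap C_2$ is an end-edge of $C_1$. (F5) If $C\in\mathcal{C}$ is a circuit then $|V(C\cap F)|\le 1$ and every vertex of $C\cap F$ has degree 1 in $F$; if $C\in\mathcal{C}$ is a path then every vertex of $C\cap F$ is an end of $C$ and has degree 0 or 2 in $F$. (F6) If $e,f$ are twinned and $C\in\mathcal{C}$ with $e\in E(C)$, then $|V(C)|\le 6$ and either: $f\in E(C)$, $C$ is a circuit, $e,f$ have a common end in $V(F)$, and no path in $\mathcal{C}$ contains any vertex of $e$ or $f$; or $f\in E(C)$, $C$ is a path with end-edges $e,f$, and $C\cap F$ is null; or $f\notin E(C)$, $C$ is a path with $|E(C)|=3$, $e$ is an end-edge of $C$, and no end of $e$ is in $V(F)$. (F7) Let $C\in\mathcal{C}$ be a path of length five with twinned end-edges $e,f$. Then $|E(C')|\le 4$ for every path $C'\in\mathcal{C}\setminus\{C\}$ containing $e$. Moreover, let $C$ have vertices $v_0,v_1,\dots,v_5$ in order; then there exists $C'\in\mathcal{C}$ with end-edges $e$ and $f$ and with ends $v_0$ and $v_4$. *)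

theory Defs
  imports Main
begin

text \<open>A graph is given by its vertex set and its set of edges, an edge being the two-element set
  of its ends.\<close>

record 'v graph =
  verts :: "'v set"
  edges :: "'v set set"

definition simple_graph :: "'v graph \<Rightarrow> bool" where
  "simple_graph G \<longleftrightarrow> finite (verts G) \<and> (\<forall>e\<in>edges G. e \<subseteq> verts G \<and> card e = 2)"

definition degree :: "'v graph \<Rightarrow> 'v \<Rightarrow> nat" where
  "degree G v = card {e \<in> edges G. v \<in> e}"

definition cubic :: "'v graph \<Rightarrow> bool" where
  "cubic G \<longleftrightarrow> (\<forall>v\<in>verts G. degree G v = 3)"

definition subgraph :: "'v graph \<Rightarrow> 'v graph \<Rightarrow> bool" where
  "subgraph H G \<longleftrightarrow> simple_graph H \<and> verts H \<subseteq> verts G \<and> edges H \<subseteq> edges G"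

definition induced_subgraph :: "'v graph \<Rightarrow> 'v graph \<Rightarrow> bool" where
  "induced_subgraph H G \<longleftrightarrow> subgraph H G \<and> edges H = {e \<in> edges G. e \<subseteq> verts H}"

definition delete_edges :: "'v graph \<Rightarrow> 'v set set \<Rightarrow> 'v graph" where
  "delete_edges G E = \<lparr>verts = verts G, edges = edges G - E\<rparr>"

definition graph_inter :: "'v graph \<Rightarrow> 'v graph \<Rightarrow> 'v graph"  (infixl "\<inter>\<^sub>G" 70) where
  "H \<inter>\<^sub>G K = \<lparr>verts = verts H \<inter> verts K, edges = edges H \<inter> edges K\<rparr>"

text \<open>The edge list of the walk through \<open>vs\<close>.\<close>

definition walk_edges :: "'v list \<Rightarrow> 'v set list" where
  "walk_edges vs = map (\<lambda>(u, v). {u, v}) (zip vs (tl vs))"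

text \<open>\<open>path_order P vs\<close>: the graph \<open>P\<close> is a path whose vertices are, in order, \<open>vs\<close>.
  Each path with at least one edge has exactly two such orders, which are reverses of each other.\<close>

definition path_order :: "'v graph \<Rightarrow> 'v list \<Rightarrow> bool" where
  "path_order P vs \<longleftrightarrow>
     vs \<noteq> [] \<and> distinct vs \<and> verts P = set vs \<and> edges P = set (walk_edges vs)"

definition is_path :: "'v graph \<Rightarrow> bool" where
  "is_path P \<longleftrightarrow> (\<exists>vs. path_order P vs)"

definition circuit_order :: "'v graph \<Rightarrow> 'v list \<Rightarrow> bool" where
  "circuit_order C vs \<longleftrightarrow>
     3 \<le> length vs \<and> distinct vs \<and> verts C = set vs \<and> edges C = set (walk_edges (vs @ [hd vs]))"

definition is_circuit :: "'v graph \<Rightarrow> bool" where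
  "is_circuit C \<longleftrightarrow> (\<exists>vs. circuit_order C vs)"

text \<open>The next two sets are empty for graphs that are not paths.\<close>

definition path_ends :: "'v graph \<Rightarrow> 'v set" where
  "path_ends P = {v. \<exists>vs. path_order P vs \<and> (v = hd vs \<or> v = last vs)}"

definition path_end_edges :: "'v graph \<Rightarrow> 'v set set" where
  "path_end_edges P =
     {e. \<exists>vs. path_order P vs \<and> walk_edges vs \<noteq> [] \<and>
           (e = hd (walk_edges vs) \<or> e = last (walk_edges vs))}"

definition adjacency :: "'v graph \<Rightarrow> ('v \<times> 'v) set" where
  "adjacency H = {(u, v). {u, v} \<in> edges H}"

definition component_of :: "'v graph \<Rightarrow> 'v \<Rightarrow> 'v graph" where
  "component_of H v =
     (let W = {w \<in> verts H. (v, w) \<in> (adjacency H)\<^sup>*}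
      in \<lparr>verts = W, edges = {e \<in> edges H. e \<subseteq> W}\<rparr>)"

definition components :: "'v graph \<Rightarrow> 'v graph set" where
  "components H = component_of H ` verts H"

definition twinned :: "'v graph set \<Rightarrow> 'v set \<Rightarrow> 'v set \<Rightarrow> bool" where
  "twinned \<C> e f \<longleftrightarrow>
     e \<noteq> f \<and> (\<exists>C\<^sub>1\<in>\<C>. \<exists>C\<^sub>2\<in>\<C>. C\<^sub>1 \<noteq> C\<^sub>2 \<and> e \<in> edges (C\<^sub>1 \<inter>\<^sub>G C\<^sub>2) \<and> f \<in> edges (C\<^sub>1 \<inter>\<^sub>G C\<^sub>2))"

locale framework =
  fixes G :: "'v graph" and F :: "'v graph" and \<C> :: "'v graph set"
  assumes simple: "simple_graph G"
    and cubic: "cubic G"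
    and subgraph_F: "subgraph F G"
    and subgraph_members: "\<And>C. C \<in> \<C> \<Longrightarrow> subgraph C (delete_edges G (edges F))"
    and F1: "\<And>C. C \<in> \<C> \<Longrightarrow>
      induced_subgraph C (delete_edges G (edges F)) \<and> 3 \<le> card (edges C) \<and>
      (is_path C \<or> is_circuit C)"
    and F2_cover: "\<And>e. e \<in> edges (delete_edges G (edges F)) \<Longrightarrow> \<exists>C\<in>\<C>. e \<in> edges C"
    and F2_pairs: "\<And>e f v. \<lbrakk>e \<in> edges G; f \<in> edges G; e \<noteq> f; v \<in> e; v \<in> f; v \<notin> verts F\<rbrakk>
      \<Longrightarrow> \<exists>C\<in>\<C>. e \<in> edges C \<and> f \<in> edges C"
    and F3: "\<And>C\<^sub>1 C\<^sub>2 v. \<lbrakk>C\<^sub>1 \<in> \<C>; C\<^sub>2 \<in> \<C>; C\<^sub>1 \<noteq> C\<^sub>2; v \<in> verts (C\<^sub>1 \<inter>\<^sub>G C\<^sub>2)\<rbrakk>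
      \<Longrightarrow> verts (C\<^sub>1 \<inter>\<^sub>G C\<^sub>2) = {v} \<or> (\<exists>e\<in>edges (C\<^sub>1 \<inter>\<^sub>G C\<^sub>2). v \<in> e) \<or> v \<in> verts F"
    and F4_end_edge: "\<And>C\<^sub>1 C e. \<lbrakk>C\<^sub>1 \<in> \<C>; is_path C\<^sub>1; C \<in> \<C>; e \<in> path_end_edges C\<^sub>1; e \<in> edges C\<rbrakk>
      \<Longrightarrow> is_path C"
    and F4_inter: "\<And>C\<^sub>1 C\<^sub>2. \<lbrakk>C\<^sub>1 \<in> \<C>; is_path C\<^sub>1; C\<^sub>2 \<in> \<C> - {C\<^sub>1}; is_path C\<^sub>2\<rbrakk>
      \<Longrightarrow> (\<forall>K\<in>components (C\<^sub>1 \<inter>\<^sub>G C\<^sub>2). verts K \<inter> path_ends C\<^sub>1 \<noteq> {}) \<and>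
          edges (C\<^sub>1 \<inter>\<^sub>G C\<^sub>2) \<subseteq> path_end_edges C\<^sub>1"
    and F5_circuit: "\<And>C. \<lbrakk>C \<in> \<C>; is_circuit C\<rbrakk>
      \<Longrightarrow> card (verts (C \<inter>\<^sub>G F)) \<le> 1 \<and> (\<forall>v\<in>verts (C \<inter>\<^sub>G F). degree F v = 1)"
    and F5_path: "\<And>C v. \<lbrakk>C \<in> \<C>; is_path C; v \<in> verts (C \<inter>\<^sub>G F)\<rbrakk>
      \<Longrightarrow> v \<in> path_ends C \<and> (degree F v = 0 \<or> degree F v = 2)"
    and F6: "\<And>e f C. \<lbrakk>twinned \<C> e f; C \<in> \<C>; e \<in> edges C\<rbrakk>
      \<Longrightarrow> card (verts C) \<le> 6 \<and>
          ((f \<in> edges C \<and> is_circuit C \<and> (\<exists>v. v \<in> e \<and> v \<in> f \<and> v \<in> verts F) \<and>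
              (\<forall>P\<in>\<C>. is_path P \<longrightarrow> verts P \<inter> (e \<union> f) = {})) \<or>
           (f \<in> edges C \<and> is_path C \<and> path_end_edges C = {e, f} \<and> verts (C \<inter>\<^sub>G F) = {}) \<or>
           (f \<notin> edges C \<and> is_path C \<and> card (edges C) = 3 \<and> e \<in> path_end_edges C \<and>
              e \<inter> verts F = {}))"
    and F7_short: "\<And>C e f C'. \<lbrakk>C \<in> \<C>; is_path C; card (edges C) = 5; path_end_edges C = {e, f};
        twinned \<C> e f; C' \<in> \<C> - {C}; is_path C'; e \<in> edges C'\<rbrakk>
      \<Longrightarrow> card (edges C') \<le> 4"
    and F7_cross: "\<And>C e f v\<^sub>0 v\<^sub>1 v\<^sub>2 v\<^sub>3 v\<^sub>4 v\<^sub>5. \<lbrakk>C \<in> \<C>; path_order C [v\<^sub>0, v\<^sub>1, v\<^sub>2, v\<^sub>3, v\<^sub>4, v\<^sub>5];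
        path_end_edges C = {e, f}; twinned \<C> e f\<rbrakk>
      \<Longrightarrow> \<exists>C'\<in>\<C>. is_path C' \<and> path_end_edges C' = {e, f} \<and> path_ends C' = {v\<^sub>0, v\<^sub>4}"

end

theory Submission
  imports Defs
begin

text \<open>Two distinct common edges of distinct members are twinned, so (F6) applies to every pair of
  common edges in both members. Either both members are circuits and any two common edges meet in
  the unique vertex \<open>v\<close> of the circuit in \<open>F\<close>; as \<open>v\<close> has degree 3 in \<open>G\<close> and 1 in \<open>F\<close>, only two
  common edges fit. Or both are paths whose end-edges are exactly the two common edges. In either
  case (F3) excludes further common vertices.\<close>

lemma card_le_2_if_no_three:
  assumes "\<And>x y z. \<lbrakk>x \<in> A; y \<in> A; z \<in> A; x \<noteq> y; x \<noteq> z; y \<noteq> z\<rbrakk> \<Longrightarrow> False"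
  shows "card A \<le> 2"
proof (rule ccontr)
  assume "\<not> card A \<le> 2"
  then have "3 \<le> card A" by simp
  then obtain B where "B \<subseteq> A" "card B = 3"
    by (meson obtain_subset_with_card_n)
  with assms show False
    by (auto simp: card_3_iff)
qed

lemma length_walk_edges: "length (walk_edges vs) = length vs - 1"
  by (simp add: walk_edges_def)

lemma nth_walk_edges:
  "Suc i < length vs \<Longrightarrow> walk_edges vs ! i = {vs ! i, vs ! Suc i}"
  by (simp add: walk_edges_def nth_tl)

text \<open>Three edges force at least four vertices, so the first two and the last two positions of
  the vertex list do not overlap.\<close>

lemma disjoint_path_end_edges:
  assumes P: "is_path P" and three: "3 \<le> card (edges P)"
    and ends: "path_end_edges P = {e, f}"
  shows "e \<inter> f = {}"
proof -
  obtain vs where vs: "path_order P vs"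
    using P unfolding is_path_def by blast
  let ?n = "length vs"
  have "card (edges P) \<le> ?n - 1"
    using vs card_length[of "walk_edges vs"] by (simp add: path_order_def length_walk_edges)
  with three have n: "4 \<le> ?n" by simp
  have ne: "walk_edges vs \<noteq> []"
    using n by (simp add: length_walk_edges flip: length_greater_0_conv)
  have first: "hd (walk_edges vs) = {vs ! 0, vs ! 1}"
    using n ne nth_walk_edges[of 0 vs] by (simp add: hd_conv_nth)
  \<comment> \<open>With \<open>?n\<close> vertices the edge list has length \<open>?n - 1\<close>,
    so its last index is \<open>?n - 2\<close>; the bound \<open>n\<close> keeps these subtractions
    from truncating at 0.\<close>
  have "Suc (?n - 2) = ?n - 1" "?n - 1 - 1 = ?n - 2" using n by simp_all
  then have last: "last (walk_edges vs) = {vs ! (?n - 2), vs ! (?n - 1)}"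
    using n ne nth_walk_edges[of "?n - 2" vs] by (simp add: last_conv_nth length_walk_edges)
  have "distinct vs" using vs by (simp add: path_order_def)
  then have disj: "hd (walk_edges vs) \<inter> last (walk_edges vs) = {}"
    using n unfolding first last by (cases "vs = []") (auto simp: nth_eq_iff_index_eq)
  have "hd (walk_edges vs) \<in> {e, f}" "last (walk_edges vs) \<in> {e, f}"
    using vs ne unfolding ends[symmetric] path_end_edges_def by blast+
  \<comment> \<open>Disjoint nonempty edges are distinct, so the first and last edges of
    \<open>vs\<close> are \<open>e\<close> and \<open>f\<close> in one of the two orders.\<close>
  moreover have "hd (walk_edges vs) \<noteq> last (walk_edges vs)"
    using disj first by auto
  ultimately show ?thesis using disj by auto
qed

context framework
begin

lemma member_edge:
  assumes "C \<in> \<C>" "e \<in> edges C"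
  shows "e \<subseteq> verts C" "card e = 2" "e \<in> edges G" "e \<notin> edges F"
  using subgraph_members[OF assms(1)] assms(2)
  by (auto simp: subgraph_def simple_graph_def delete_edges_def)

text \<open>A common edge supplies two common vertices, which eliminates the first alternative of
  \<open>F3\<close>; the other two remain.\<close>

lemma verts_inter_subset:
  assumes "C\<^sub>1 \<in> \<C>" "C\<^sub>2 \<in> \<C>" "C\<^sub>1 \<noteq> C\<^sub>2" and e: "e \<in> edges (C\<^sub>1 \<inter>\<^sub>G C\<^sub>2)"
  shows "verts (C\<^sub>1 \<inter>\<^sub>G C\<^sub>2) \<subseteq> \<Union> (edges (C\<^sub>1 \<inter>\<^sub>G C\<^sub>2)) \<union> verts F"
proof
  fix x assume x: "x \<in> verts (C\<^sub>1 \<inter>\<^sub>G C\<^sub>2)"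
  have "e \<subseteq> verts (C\<^sub>1 \<inter>\<^sub>G C\<^sub>2)" "card e = 2"
    using member_edge[OF assms(1)] member_edge[OF assms(2)] e by (auto simp: graph_inter_def)
  then have "verts (C\<^sub>1 \<inter>\<^sub>G C\<^sub>2) \<noteq> {x}"
    by (metis One_nat_def card.empty card.insert empty_iff finite.emptyI numeral_2_eq_2
        subset_singleton_iff n_not_Suc_n zero_neq_numeral)
  then show "x \<in> \<Union> (edges (C\<^sub>1 \<inter>\<^sub>G C\<^sub>2)) \<union> verts F"
    using F3[OF assms(1-3) x] by blast
qed

text \<open>Members avoid the edges of \<open>F\<close>, so of the three edges of \<open>G\<close>
  at \<open>v\<close> the single one in \<open>F\<close> is lost to \<open>C\<close>. Finiteness is
  recorded so that the bound passes to subsets.\<close>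

lemma circuit_edges_at_F:
  assumes C: "C \<in> \<C>" "is_circuit C" and v: "v \<in> verts C" "v \<in> verts F"
  shows "finite {e \<in> edges C. v \<in> e}" "card {e \<in> edges C. v \<in> e} \<le> 2"
proof -
  have "degree F v = 1"
    using F5_circuit[OF C] v by (simp add: graph_inter_def)
  then have F1: "card {e \<in> edges F. v \<in> e} = 1" by (simp add: degree_def)
  have "v \<in> verts G" using v(2) subgraph_F by (auto simp: subgraph_def)
  then have G3: "card {e \<in> edges G. v \<in> e} = 3"
    using cubic by (simp add: cubic_def degree_def)
  \<comment> \<open>An infinite set has \<open>card\<close> 0, so cardinality 3 already gives
    finiteness.\<close>
  then have fin: "finite {e \<in> edges G. v \<in> e}"
    by (metis card.infinite zero_neq_numeral)
  have sub: "{e \<in> edges F. v \<in> e} \<subseteq> {e \<in> edges G. v \<in> e}"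
    using subgraph_F by (auto simp: subgraph_def)
  have diff: "{e \<in> edges C. v \<in> e} \<subseteq> {e \<in> edges G. v \<in> e} - {e \<in> edges F. v \<in> e}"
    using member_edge[OF C(1)] by blast
  show "finite {e \<in> edges C. v \<in> e}"
    using diff fin by (meson finite_Diff finite_subset)
  have "card ({e \<in> edges G. v \<in> e} - {e \<in> edges F. v \<in> e}) = 2"
    using card_Diff_subset[OF finite_subset[OF sub fin] sub] F1 G3 by simp
  then show "card {e \<in> edges C. v \<in> e} \<le> 2"
    using card_mono[OF finite_Diff[OF fin] diff] by simp
qed

lemma twinned_commonI:
  assumes "C\<^sub>1 \<in> \<C>" "C\<^sub>2 \<in> \<C>" "C\<^sub>1 \<noteq> C\<^sub>2" "e \<noteq> f"
    and "e \<in> edges (C\<^sub>1 \<inter>\<^sub>G C\<^sub>2)" "f \<in> edges (C\<^sub>1 \<inter>\<^sub>G C\<^sub>2)"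
  shows "twinned \<C> e f"
  using assms unfolding twinned_def by blast

text \<open>Since both members contain both edges, the third alternative of \<open>F6\<close> is
  impossible for either. A mixture of the other two is also impossible: the circuit alternative
  keeps every path of the family away from \<open>e\<close> and \<open>f\<close>, while each member
  meets them.\<close>

lemma common_edges_cases:
  assumes C: "C\<^sub>1 \<in> \<C>" "C\<^sub>2 \<in> \<C>" "C\<^sub>1 \<noteq> C\<^sub>2" and "e \<noteq> f"
    and e: "e \<in> edges (C\<^sub>1 \<inter>\<^sub>G C\<^sub>2)" and f: "f \<in> edges (C\<^sub>1 \<inter>\<^sub>G C\<^sub>2)"
  obtains
    (circuits) v where "is_circuit C\<^sub>1" "is_circuit C\<^sub>2" "v \<in> e" "v \<in> f" "v \<in> verts F"
      "\<And>P. \<lbrakk>P \<in> \<C>; is_path P\<rbrakk> \<Longrightarrow> verts P \<inter> (e \<union> f) = {}"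
  | (paths) "is_path C\<^sub>1" "is_path C\<^sub>2" "path_end_edges C\<^sub>1 = {e, f}" "path_end_edges C\<^sub>2 = {e, f}"
      "verts (C\<^sub>1 \<inter>\<^sub>G F) = {}" "verts (C\<^sub>2 \<inter>\<^sub>G F) = {}"
proof -
  have tw: "twinned \<C> e f" using twinned_commonI[OF assms] .
  have in1: "e \<in> edges C\<^sub>1" "f \<in> edges C\<^sub>1" and in2: "e \<in> edges C\<^sub>2" "f \<in> edges C\<^sub>2"
    using e f by (auto simp: graph_inter_def)
  have "e \<noteq> {}" using member_edge(2)[OF C(1) in1(1)] by auto
  then have meet: "verts C\<^sub>1 \<inter> (e \<union> f) \<noteq> {}" "verts C\<^sub>2 \<inter> (e \<union> f) \<noteq> {}"
    using member_edge(1)[OF C(1) in1(1)] member_edge(1)[OF C(2) in2(1)] by auto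
  from F6[OF tw C(1) in1(1)] F6[OF tw C(2) in2(1)] in1 in2 meet C that
  show thesis by (smt (verit, best))
qed

text \<open>Each pair of common edges shares a vertex in \<open>F\<close>; by
  \<open>F5_circuit\<close> the circuit has only one such vertex, so the pairs all share the same
  one.\<close>

lemma circuit_common_edges_meet:
  assumes C: "C\<^sub>1 \<in> \<C>" "C\<^sub>2 \<in> \<C>" "C\<^sub>1 \<noteq> C\<^sub>2" and no_path: "\<not> (is_path C\<^sub>1 \<and> is_path C\<^sub>2)"
    and ne: "e \<noteq> f" and e: "e \<in> edges (C\<^sub>1 \<inter>\<^sub>G C\<^sub>2)" and f: "f \<in> edges (C\<^sub>1 \<inter>\<^sub>G C\<^sub>2)"
  obtains v where "is_circuit C\<^sub>1" "is_circuit C\<^sub>2" "verts (C\<^sub>1 \<inter>\<^sub>G F) = {v}"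
    "\<And>g. g \<in> edges (C\<^sub>1 \<inter>\<^sub>G C\<^sub>2) \<Longrightarrow> v \<in> g"
proof -
  have in1: "g \<in> edges (C\<^sub>1 \<inter>\<^sub>G C\<^sub>2) \<Longrightarrow> g \<subseteq> verts C\<^sub>1" for g
    using member_edge(1)[OF C(1)] by (auto simp: graph_inter_def)
  obtain v where v: "is_circuit C\<^sub>1" "is_circuit C\<^sub>2" "v \<in> e" "v \<in> f" "v \<in> verts F"
    using common_edges_cases[OF C ne e f] no_path by metis
  have "finite (verts C\<^sub>1)"
    using subgraph_members[OF C(1)] by (simp add: subgraph_def simple_graph_def)
  \<comment> \<open>Finiteness turns the bound \<open>card \<le> 1\<close> into a genuine
    restriction, as an infinite set would have \<open>card\<close> 0.\<close>
  then have "finite (verts (C\<^sub>1 \<inter>\<^sub>G F))" by (simp add: graph_inter_def)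
  moreover have "v \<in> verts (C\<^sub>1 \<inter>\<^sub>G F)"
    using v in1[OF e] by (auto simp: graph_inter_def)
  moreover have "card (verts (C\<^sub>1 \<inter>\<^sub>G F)) \<le> 1"
    using F5_circuit[OF C(1) v(1)] by blast
  ultimately have single: "verts (C\<^sub>1 \<inter>\<^sub>G F) = {v}"
    by (metis One_nat_def card_le_Suc0_iff_eq is_singletonI' is_singleton_the_elem singletonD empty_iff)
  have "v \<in> g" if g: "g \<in> edges (C\<^sub>1 \<inter>\<^sub>G C\<^sub>2)" for g
  proof (cases "g = e")
    case False
    \<comment> \<open>Pairing \<open>g\<close> with the fixed edge \<open>e\<close> yields a vertex
      of \<open>F\<close> on \<open>g\<close>, which must be \<open>v\<close>.\<close>
    then obtain u where u: "u \<in> g" "u \<in> verts F"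
      using common_edges_cases[OF C False g e] no_path by metis
    then have "u \<in> verts (C\<^sub>1 \<inter>\<^sub>G F)"
      using in1[OF g] by (auto simp: graph_inter_def)
    with single u show ?thesis by simp
  qed (use v in simp)
  with v single that show thesis by blast
qed

end

theorem theorem3p2:
  fixes G F :: "'v graph" and \<C> :: "'v graph set" and C\<^sub>1 C\<^sub>2 :: "'v graph"
  assumes "framework G F \<C>"
    and "C\<^sub>1 \<in> \<C>" and "C\<^sub>2 \<in> \<C>" and "C\<^sub>1 \<noteq> C\<^sub>2"
  shows "card (edges (C\<^sub>1 \<inter>\<^sub>G C\<^sub>2)) \<le> 2 \<and>
    (card (edges (C\<^sub>1 \<inter>\<^sub>G C\<^sub>2)) = 2 \<longrightarrow>
      (is_circuit C\<^sub>1 \<and> is_circuit C\<^sub>2 \<and>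
        (\<exists>u v w. path_order (C\<^sub>1 \<inter>\<^sub>G C\<^sub>2) [u, v, w] \<and> v \<in> verts F \<and> degree F v = 1)) \<or>
      (is_path C\<^sub>1 \<and> is_path C\<^sub>2 \<and>
        (\<exists>e f. path_end_edges C\<^sub>1 = {e, f} \<and> path_end_edges C\<^sub>2 = {e, f} \<and> e \<inter> f = {} \<and>
          edges (C\<^sub>1 \<inter>\<^sub>G C\<^sub>2) = {e, f} \<and> verts (C\<^sub>1 \<inter>\<^sub>G C\<^sub>2) = e \<union> f) \<and>
        verts (C\<^sub>1 \<inter>\<^sub>G F) = {} \<and> verts (C\<^sub>2 \<inter>\<^sub>G F) = {}))"
proof -
  interpret framework G F \<C> by fact
  note C = assms(2-4)
  let ?I = "C\<^sub>1 \<inter>\<^sub>G C\<^sub>2"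
  have in1: "g \<in> edges C\<^sub>1" if "g \<in> edges ?I" for g
    using that by (simp add: graph_inter_def)
  have edge: "g \<subseteq> verts ?I" "card g = 2" if "g \<in> edges ?I" for g
    using that member_edge[OF C(1)] member_edge[OF C(2)] by (auto simp: graph_inter_def)
  show ?thesis
  proof (cases "is_path C\<^sub>1 \<and> is_path C\<^sub>2")
    case False
    show ?thesis
    proof (cases "\<exists>e f. e \<noteq> f \<and> e \<in> edges ?I \<and> f \<in> edges ?I")
      case True
      then obtain e f where ef: "e \<noteq> f" "e \<in> edges ?I" "f \<in> edges ?I" by blast
      obtain v where v: "is_circuit C\<^sub>1" "is_circuit C\<^sub>2" "verts (C\<^sub>1 \<inter>\<^sub>G F) = {v}"
        "\<And>g. g \<in> edges ?I \<Longrightarrow> v \<in> g"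
        using circuit_common_edges_meet[OF C False ef] by metis
      have vF: "v \<in> verts C\<^sub>1" "v \<in> verts F"
        using v(3) by (auto simp: graph_inter_def)
      have sub: "edges ?I \<subseteq> {g \<in> edges C\<^sub>1. v \<in> g}"
        using v(4) in1 by blast
      note at_v = circuit_edges_at_F[OF C(1) v(1) vF]
      have le: "card (edges ?I) \<le> 2"
        using card_mono[OF at_v(1) sub] at_v(2) by simp
      \<comment> \<open>Two distinct members already exhaust a finite set of cardinality at most
        2.\<close>
      have "edges ?I = {e, f}"
        using ef le card_seteq[OF finite_subset[OF sub at_v(1)], of "{e, f}"] by auto
      moreover obtain u where u: "e = {u, v}" "u \<noteq> v"
        using edge(2)[OF ef(2)] v(4)[OF ef(2)] by (auto simp: card_2_iff)
      moreover obtain w where w: "f = {v, w}" "w \<noteq> v"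
        using edge(2)[OF ef(3)] v(4)[OF ef(3)] by (auto simp: card_2_iff)
      ultimately have edges: "edges ?I = {{u, v}, {v, w}}" by simp
      \<comment> \<open>A common vertex in \<open>F\<close> can only be \<open>v\<close>; any other
        common vertex lies on a common edge.\<close>
      have "x \<in> {u, v, w}" if x: "x \<in> verts ?I" for x
      proof (cases "x \<in> verts F")
        case True
        then have "x \<in> verts (C\<^sub>1 \<inter>\<^sub>G F)" using x by (simp add: graph_inter_def)
        with v(3) show ?thesis by simp
      next
        case False
        with verts_inter_subset[OF C ef(2)] x edges show ?thesis by auto
      qed
      moreover have "{u, v, w} \<subseteq> verts ?I"
        using edge(1)[OF ef(2)] edge(1)[OF ef(3)] u w by auto
      ultimately have "verts ?I = {u, v, w}" by blast
      \<comment> \<open>Here \<open>u\<close> and \<open>w\<close> differ because \<open>e\<close>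
        and \<open>f\<close> do.\<close>
      then have "path_order ?I [u, v, w]"
        using edges ef(1) u w by (auto simp: path_order_def walk_edges_def)
      moreover have "degree F v = 1"
        using F5_circuit[OF C(1) v(1)] v(3) by simp
      ultimately show ?thesis using le v(1,2) vF(2) by blast
    next
      case False
      \<comment> \<open>With no two distinct common edges, both cardinality 2 and a triple of common
        edges are excluded.\<close>
      then have "card (edges ?I) \<noteq> 2" by (auto simp: card_2_iff)
      moreover have "card (edges ?I) \<le> 2"
        by (rule card_le_2_if_no_three) (use False in blast)
      ultimately show ?thesis by blast
    qed
  next
    case True
    \<comment> \<open>The circuit outcome would forbid the path \<open>C\<^sub>1\<close> from
      meeting \<open>e \<union> f\<close>, although it contains \<open>e\<close>.\<close>
    have ends: "path_end_edges C\<^sub>1 = {e, f}" "path_end_edges C\<^sub>2 = {e, f}"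
        "verts (C\<^sub>1 \<inter>\<^sub>G F) = {}" "verts (C\<^sub>2 \<inter>\<^sub>G F) = {}"
      if ef: "e \<noteq> f" "e \<in> edges ?I" "f \<in> edges ?I" for e f
    proof -
      have "e \<noteq> {}" using edge(2)[OF ef(2)] by auto
      then have "verts C\<^sub>1 \<inter> (e \<union> f) \<noteq> {}"
        using edge(1)[OF ef(2)] by (auto simp: graph_inter_def)
      then have "path_end_edges C\<^sub>1 = {e, f} \<and> path_end_edges C\<^sub>2 = {e, f} \<and>
          verts (C\<^sub>1 \<inter>\<^sub>G F) = {} \<and> verts (C\<^sub>2 \<inter>\<^sub>G F) = {}"
        using common_edges_cases[OF C ef] True C(1) by metis
      then show "path_end_edges C\<^sub>1 = {e, f}" "path_end_edges C\<^sub>2 = {e, f}"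
        "verts (C\<^sub>1 \<inter>\<^sub>G F) = {}" "verts (C\<^sub>2 \<inter>\<^sub>G F) = {}" by blast+
    qed
    have "card (edges ?I) \<le> 2"
    proof (rule card_le_2_if_no_three)
      fix e f g assume "e \<in> edges ?I" "f \<in> edges ?I" "g \<in> edges ?I" "e \<noteq> f" "e \<noteq> g" "f \<noteq> g"
      \<comment> \<open>Both pairs equal the set of end-edges of \<open>C\<^sub>1\<close>, so a
        third common edge has no room.\<close>
      then have "{e, f} = {e, g}" using ends(1)[of e f] ends(1)[of e g] by simp
      with \<open>f \<noteq> g\<close> \<open>e \<noteq> f\<close> show False by blast
    qed
    moreover have "\<exists>e f. path_end_edges C\<^sub>1 = {e, f} \<and> path_end_edges C\<^sub>2 = {e, f} \<and> e \<inter> f = {} \<and>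
          edges ?I = {e, f} \<and> verts ?I = e \<union> f"
      and "verts (C\<^sub>1 \<inter>\<^sub>G F) = {}" and "verts (C\<^sub>2 \<inter>\<^sub>G F) = {}" if two: "card (edges ?I) = 2"
    proof -
      obtain e f where edges: "edges ?I = {e, f}" and "e \<noteq> f"
        using two by (auto simp: card_2_iff)
      then have ef: "e \<noteq> f" "e \<in> edges ?I" "f \<in> edges ?I" by auto
      note ends = ends[OF ef]
      show "verts (C\<^sub>1 \<inter>\<^sub>G F) = {}" "verts (C\<^sub>2 \<inter>\<^sub>G F) = {}" by (fact ends)+
      have "e \<inter> f = {}"
        using disjoint_path_end_edges[OF _ _ ends(1)] True F1[OF C(1)] by blast
      \<comment> \<open>As \<open>C\<^sub>1\<close> misses \<open>F\<close>, every common vertex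
        must lie on \<open>e\<close> or \<open>f\<close>.\<close>
      moreover have "verts ?I \<inter> verts F = {}"
        using ends(3) by (auto simp: graph_inter_def)
      then have "verts ?I = e \<union> f"
        using verts_inter_subset[OF C ef(2)] edge(1)[OF ef(2)] edge(1)[OF ef(3)] edges by auto
      ultimately show "\<exists>e f. path_end_edges C\<^sub>1 = {e, f} \<and> path_end_edges C\<^sub>2 = {e, f} \<and> e \<inter> f = {} \<and>
          edges ?I = {e, f} \<and> verts ?I = e \<union> f"
        using ends edges by blast
    qed
    ultimately show ?thesis using True by blast
  qed
qed

end
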